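(* Let $H=(V,E,w)$ be a connected weighted hypergraph and let $s\in\mathbb R^V$ satisfy $\mathbf 1^\top s=0$. Then the affine set $\{\eta\in\mathcal Y: B\eta=s\}$ is nonempty, and $$\mathrm{OPT}=\min_{x\in\mathcal X_0}\mathcal P(x)=-\min_{\eta\in\mathcal Y,\ B\eta=s}\ \sum_{e\in E}\frac{\|\eta_e\|_1^2}{8w_e}.$$ In particular, writing $\mathcal D(\eta):=\sum_{e\in E}\frac{\|\eta_e\|_1^2}{8w_e}$ and $\mathcal D^\star:=\min_{\eta\in\mathcal Y,\ B\eta=s}\mathcal D(\eta)$, one has $\mathrm{OPT}=-\mathcal D^\star$.
   Context: A weighted hypergraph $H=(V,E,w)$ has a finite vertex set $V$, a finite nonempty family $E$ of nonempty subsets of $V$ (hyperedges), and weights $w_e>0$. It is connected if any two vertices $u,v$ are joined by a sequence $u=p_0,p_1,\dots,p_k=v$ of vertices and hyperedges $e_1,\dots,e_k$ with $p_{i-1},p_i\in e_i$. For $x\in\mathbb R^V$, $R_e(x):=\max_{u\in e}x_u-\min_{v\in e}x_v$. Let $d_v:=\sum_{e\ni v}w_e$, $D:=\mathrm{diag}(d_v)$, $\mathcal X_0:=\{x\in\mathbb R^V:\langle Dx,\mathbf 1\rangle=0\}$, $\mathcal P(x):=\frac12\sum_{e\in E}w_eR_e(x)^2-\langle s,x\rangle$, and $\mathrm{OPT}:=\min_{x\in\mathcal X_0}\mathcal P(x)$. For $e\in E$, $U_e:=\{\eta\in\mathbb R^V:\operatorname{supp}(\eta)\subseteq e,\ \mathbf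 1^\top\eta=0\}$; $\mathcal Y:=\prod_{e\in E}U_e$; $B\eta:=\sum_{e\in E}\eta_e\in\mathbb R^V$. *)

theory Defs
  imports "HOL-Analysis.Analysis"
begin

text \<open>
  The vertex set is the finite type \<open>'v\<close>, so that vectors indexed by vertices have type
  \<open>real ^ 'v\<close>. Hyperedges are sets of vertices; the family of hyperedges is a
  \<open>'v set set\<close>, which is automatically finite, and the weight function is only constrained
  (and only used) on hyperedges.
\<close>

definition weighted_hypergraph :: "'v::finite set set \<Rightarrow> ('v set \<Rightarrow> real) \<Rightarrow> bool" where
  "weighted_hypergraph E w \<longleftrightarrow> E \<noteq> {} \<and> (\<forall>e\<in>E. e \<noteq> {}) \<and> (\<forall>e\<in>E. w e > 0)"

definition hypergraph_connected :: "'v::finite set set \<Rightarrow> bool" where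
  "hypergraph_connected E \<longleftrightarrow>
     (\<forall>u v. \<exists>(k::nat) (p :: nat \<Rightarrow> 'v) (e :: nat \<Rightarrow> 'v set).
        p 0 = u \<and> p k = v \<and> (\<forall>i\<in>{1..k}. e i \<in> E \<and> p (i - 1) \<in> e i \<and> p i \<in> e i))"

definition edge_range :: "'v::finite set \<Rightarrow> real ^ 'v \<Rightarrow> real" where
  "edge_range e x = Max ((\<lambda>u. x $ u) ` e) - Min ((\<lambda>v. x $ v) ` e)"

definition degree :: "'v::finite set set \<Rightarrow> ('v set \<Rightarrow> real) \<Rightarrow> 'v \<Rightarrow> real" where
  "degree E w v = (\<Sum>e\<in>{e\<in>E. v \<in> e}. w e)"

definition degree_matrix :: "'v::finite set set \<Rightarrow> ('v set \<Rightarrow> real) \<Rightarrow> real ^ 'v ^ 'v" where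
  "degree_matrix E w = (\<chi> i j. if i = j then degree E w i else 0)"

text \<open>The vector \<open>1 :: real ^ 'v\<close> is the all-ones vector.\<close>

definition centered_space :: "'v::finite set set \<Rightarrow> ('v set \<Rightarrow> real) \<Rightarrow> (real ^ 'v) set" where
  "centered_space E w = {x. (degree_matrix E w *v x) \<bullet> 1 = 0}"

definition primal_energy ::
  "'v::finite set set \<Rightarrow> ('v set \<Rightarrow> real) \<Rightarrow> real ^ 'v \<Rightarrow> real ^ 'v \<Rightarrow> real" where
  "primal_energy E w s x = 1 / 2 * (\<Sum>e\<in>E. w e * (edge_range e x)\<^sup>2) - s \<bullet> x"

definition edge_flows :: "'v::finite set \<Rightarrow> (real ^ 'v) set" where
  "edge_flows e = {\<eta>. {v. \<eta> $ v \<noteq> 0} \<subseteq> e \<and> 1 \<bullet> \<eta> = 0}"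

definition flow_space :: "'v::finite set set \<Rightarrow> ('v set \<Rightarrow> real ^ 'v) set" where
  "flow_space E = (\<Pi>\<^sub>E e\<in>E. edge_flows e)"

definition boundary :: "'v::finite set set \<Rightarrow> ('v set \<Rightarrow> real ^ 'v) \<Rightarrow> real ^ 'v" where
  "boundary E \<eta> = (\<Sum>e\<in>E. \<eta> e)"

definition feasible_flows ::
  "'v::finite set set \<Rightarrow> real ^ 'v \<Rightarrow> ('v set \<Rightarrow> real ^ 'v) set" where
  "feasible_flows E s = {\<eta> \<in> flow_space E. boundary E \<eta> = s}"

text \<open>The library norm on \<open>real ^ 'v\<close> is the Euclidean one.\<close>

definition l1_norm :: "real ^ 'v::finite \<Rightarrow> real" where
  "l1_norm z = (\<Sum>v\<in>UNIV. \<bar>z $ v\<bar>)"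

definition dual_energy ::
  "'v::finite set set \<Rightarrow> ('v set \<Rightarrow> real) \<Rightarrow> ('v set \<Rightarrow> real ^ 'v) \<Rightarrow> real" where
  "dual_energy E w \<eta> = (\<Sum>e\<in>E. (l1_norm (\<eta> e))\<^sup>2 / (8 * w e))"

text \<open>
  Minimum values are least elements of the set of values. \<open>LEAST\<close> is meaningful only if
  the minimum is attained, so attainment has to be asserted separately.
\<close>

definition OPT :: "'v::finite set set \<Rightarrow> ('v set \<Rightarrow> real) \<Rightarrow> real ^ 'v \<Rightarrow> real" where
  "OPT E w s = (LEAST m. m \<in> primal_energy E w s ` centered_space E w)"

definition dual_OPT :: "'v::finite set set \<Rightarrow> ('v set \<Rightarrow> real) \<Rightarrow> real ^ 'v \<Rightarrow> real" where
  "dual_OPT E w s = (LEAST m. m \<in> dual_energy E w ` feasible_flows E s)"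

end

theory Submission
  imports Defs
begin

text \<open>
  Weak duality is the Hoelder inequality on each hyperedge followed by AM-GM. For strong duality,
  let \<open>x\<close> minimise the primal energy; it exists because \<open>\<Sum>e. w\<^sub>e R\<^sub>e\<^sup>2\<close> is homogeneous of degree two
  and positive on the unit sphere of the centered space. The range \<open>R\<^sub>e\<close> is the maximum of finitely
  many linear forms, given by the dipoles \<open>\<delta>\<^sub>u - \<delta>\<^sub>v\<close> with \<open>u, v \<in> e\<close>, so the subdifferential of the
  quadratic part at \<open>x\<close> is the convex hull of the sums \<open>\<Sum>e. w\<^sub>e R\<^sub>e(x) a\<^sub>e\<close> of dipoles active at \<open>x\<close>.
  If \<open>s\<close> were outside this hull, a separating direction would be a descent direction. Hence \<open>s\<close> is
  the boundary of a flow \<open>\<eta>\<close> with \<open>\<parallel>\<eta>\<^sub>e\<parallel>\<^sub>1 \<le> 2 w\<^sub>e R\<^sub>e(x)\<close>, which is feasible and closes the duality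
  gap.
\<close>

section \<open>Dipoles and the range of a hyperedge\<close>

definition dipoles :: "'v::finite set \<Rightarrow> (real ^ 'v) set" where
  "dipoles e = (\<lambda>(u, v). axis u 1 - axis v 1) ` (e \<times> e)"

lemma finite_dipoles [simp]: "finite (dipoles e)"
  unfolding dipoles_def by simp

lemma inner_dipole: "(axis u 1 - axis v 1 :: real ^ 'v::finite) \<bullet> x = x $ u - x $ v"
  by (simp add: inner_diff_left inner_axis')

lemma dipole_inner_le_edge_range:
  assumes "a \<in> dipoles e"
  shows "a \<bullet> x \<le> edge_range e x"
proof -
  obtain u v where uv: "u \<in> e" "v \<in> e" "a = axis u 1 - axis v 1"
    using assms by (auto simp: dipoles_def)
  have "x $ u \<le> Max ((\<lambda>u. x $ u) ` e)" "Min ((\<lambda>u. x $ u) ` e) \<le> x $ v"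
    using uv by simp_all
  then show ?thesis
    unfolding uv(3) inner_dipole edge_range_def by (rule diff_mono)
qed

text \<open>Together with the preceding bound, this makes the range a maximum of finitely many
  linear forms; homogeneity, translation invariance and convexity below rest on these two facts
  rather than on \<open>Max\<close> and \<open>Min\<close>.\<close>

lemma edge_range_attained:
  assumes "e \<noteq> {}"
  obtains a where "a \<in> dipoles e" "a \<bullet> x = edge_range e x"
proof -
  have "Max ((\<lambda>u. x $ u) ` e) \<in> (\<lambda>u. x $ u) ` e" "Min ((\<lambda>u. x $ u) ` e) \<in> (\<lambda>u. x $ u) ` e"
    using assms by (auto intro!: Max_in Min_in)
  then obtain u v where uv: "u \<in> e" "v \<in> e"
      "Max ((\<lambda>u. x $ u) ` e) = x $ u" "Min ((\<lambda>u. x $ u) ` e) = x $ v"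
    by auto
  then have "axis u 1 - axis v 1 \<in> dipoles e"
    by (auto simp: dipoles_def)
  with uv show ?thesis
    using that by (simp add: inner_dipole edge_range_def)
qed

lemma edge_range_nonneg: "e \<noteq> {} \<Longrightarrow> 0 \<le> edge_range e x"
proof -
  assume "e \<noteq> {}"
  then obtain u where "u \<in> e" by auto
  then have "axis u 1 - axis u 1 \<in> dipoles e"
    unfolding dipoles_def by force
  from dipole_inner_le_edge_range [OF this] show ?thesis by simp
qed

lemma edge_range_diff_le:
  assumes "u \<in> e" "v \<in> e"
  shows "x $ u - x $ v \<le> edge_range e x"
proof -
  have "axis u 1 - axis v 1 \<in> dipoles e"
    using assms by (auto simp: dipoles_def)
  from dipole_inner_le_edge_range [OF this] show ?thesis by (simp add: inner_dipole)
qed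

lemma edge_range_scaleR:
  assumes "e \<noteq> {}" "0 \<le> r"
  shows "edge_range e (r *\<^sub>R x) = r * edge_range e x"
proof (rule antisym)
  obtain a where a: "a \<in> dipoles e" "a \<bullet> (r *\<^sub>R x) = edge_range e (r *\<^sub>R x)"
    using edge_range_attained [OF assms(1)] .
  then show "edge_range e (r *\<^sub>R x) \<le> r * edge_range e x"
    using mult_left_mono [OF dipole_inner_le_edge_range [OF a(1), of x] assms(2)] by simp
  obtain b where b: "b \<in> dipoles e" "b \<bullet> x = edge_range e x"
    using edge_range_attained [OF assms(1)] .
  then show "r * edge_range e x \<le> edge_range e (r *\<^sub>R x)"
    using dipole_inner_le_edge_range [OF b(1), of "r *\<^sub>R x"] by simp
qed

lemma edge_range_add_const:
  assumes "e \<noteq> {}"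
  shows "edge_range e (x + c *\<^sub>R 1) = edge_range e x"
proof -
  have shift: "a \<bullet> (x + c *\<^sub>R 1) = a \<bullet> x" if "a \<in> dipoles e" for a
    using that by (auto simp: dipoles_def inner_dipole)
  show ?thesis
  proof (rule antisym)
    obtain a where "a \<in> dipoles e" "a \<bullet> (x + c *\<^sub>R 1) = edge_range e (x + c *\<^sub>R 1)"
      using edge_range_attained [OF assms] .
    then show "edge_range e (x + c *\<^sub>R 1) \<le> edge_range e x"
      using dipole_inner_le_edge_range shift by metis
    obtain b where "b \<in> dipoles e" "b \<bullet> x = edge_range e x"
      using edge_range_attained [OF assms] .
    then show "edge_range e x \<le> edge_range e (x + c *\<^sub>R 1)"
      using dipole_inner_le_edge_range shift by metis
  qed
qed

text \<open>A maximum of linear forms is convex, and a real-valued convex function on the whole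
  finite-dimensional space is continuous.\<close>

lemma continuous_on_edge_range:
  assumes "e \<noteq> {}"
  shows "continuous_on S (edge_range e)"
proof -
  have "convex_on UNIV (edge_range e)"
  proof (rule convex_onI)
    fix t :: real and x y :: "real ^ 'a"
    assume t: "0 < t" "t < 1"
    obtain a where a: "a \<in> dipoles e"
        "a \<bullet> ((1 - t) *\<^sub>R x + t *\<^sub>R y) = edge_range e ((1 - t) *\<^sub>R x + t *\<^sub>R y)"
      using edge_range_attained [OF assms] .
    have "(1 - t) * (a \<bullet> x) + t * (a \<bullet> y) \<le> (1 - t) * edge_range e x + t * edge_range e y"
      using t by (intro add_mono mult_left_mono dipole_inner_le_edge_range a) auto
    then show "edge_range e ((1 - t) *\<^sub>R x + t *\<^sub>R y) \<le> (1 - t) * edge_range e x + t * edge_range e y"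
      using a(2) by (simp add: inner_add_right)
  qed simp
  then show ?thesis
    using convex_on_continuous [OF open_UNIV] continuous_on_subset by blast
qed

section \<open>Flows on a hyperedge, their l1 norm, and weak duality\<close>

lemma subspace_edge_flows: "subspace (edge_flows e)"
proof -
  have "edge_flows e = {\<eta>. (\<forall>v. v \<notin> e \<longrightarrow> \<eta> $ v = 0) \<and> 1 \<bullet> \<eta> = 0}"
    by (auto simp: edge_flows_def)
  then show ?thesis
    by (simp add: subspace_def inner_add_right)
qed

lemma dipoles_subset_edge_flows: "dipoles e \<subseteq> edge_flows e"
  by (auto simp: dipoles_def edge_flows_def axis_def inner_vec_def sum_subtractf split: if_splits)

lemma l1_norm_nonneg: "0 \<le> l1_norm z"
  unfolding l1_norm_def by (simp add: sum_nonneg)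

lemma l1_norm_add_le: "l1_norm (y + z) \<le> l1_norm y + l1_norm z"
  unfolding l1_norm_def by (simp add: sum.distrib [symmetric] sum_mono)

lemma l1_norm_scaleR: "l1_norm (r *\<^sub>R z) = \<bar>r\<bar> * l1_norm z"
  unfolding l1_norm_def by (simp add: abs_mult sum_distrib_left)

lemma l1_norm_dipole_le:
  assumes "a \<in> dipoles e"
  shows "l1_norm a \<le> 2"
proof -
  have unit: "l1_norm (axis u 1) = 1" for u :: 'a
    unfolding l1_norm_def axis_def by (simp add: if_distrib cong: if_cong)
  obtain u v where "a = axis u 1 - axis v 1"
    using assms by (auto simp: dipoles_def)
  then show ?thesis
    using l1_norm_add_le [of "axis u 1" "- axis v 1"] l1_norm_scaleR [of "-1" "axis v 1"]
    by (simp add: unit)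
qed

text \<open>The coordinates of the flow sum to zero, so \<open>x\<close> may be shifted by the
  midpoint of its extreme values on \<open>e\<close>. Each shifted coordinate on \<open>e\<close> is
  then at most half the range in absolute value, whence the factor 1/2.\<close>

lemma edge_flow_inner_le:
  assumes "\<eta> \<in> edge_flows e" "e \<noteq> {}"
  shows "\<eta> \<bullet> x \<le> l1_norm \<eta> / 2 * edge_range e x"
proof -
  define M where "M = Max ((\<lambda>u. x $ u) ` e)"
  define m where "m = Min ((\<lambda>u. x $ u) ` e)"
  have zero: "(\<Sum>v\<in>UNIV. \<eta> $ v) = 0"
    using assms(1) by (simp add: edge_flows_def inner_vec_def)
  have "\<eta> \<bullet> x = (\<Sum>v\<in>UNIV. \<eta> $ v * x $ v) - (M + m) / 2 * (\<Sum>v\<in>UNIV. \<eta> $ v)"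
    by (simp add: zero) (simp add: inner_vec_def)
  also have "\<dots> = (\<Sum>v\<in>UNIV. \<eta> $ v * (x $ v - (M + m) / 2))"
    unfolding sum_distrib_left sum_subtractf [symmetric]
    by (intro sum.cong refl) (simp add: algebra_simps)
  also have "\<dots> \<le> (\<Sum>v\<in>UNIV. \<bar>\<eta> $ v\<bar> * ((M - m) / 2))"
  proof (rule sum_mono)
    fix v
    show "\<eta> $ v * (x $ v - (M + m) / 2) \<le> \<bar>\<eta> $ v\<bar> * ((M - m) / 2)"
    proof (cases "v \<in> e")
      case True
      then have "x $ v \<le> M" "m \<le> x $ v"
        by (auto simp: M_def m_def)
      then have "\<bar>x $ v - (M + m) / 2\<bar> \<le> (M - m) / 2"
        by (simp add: abs_le_iff field_simps)
      then have "\<bar>\<eta> $ v\<bar> * \<bar>x $ v - (M + m) / 2\<bar> \<le> \<bar>\<eta> $ v\<bar> * ((M - m) / 2)"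
        by (rule mult_left_mono) simp
      then show ?thesis
        using abs_ge_self [of "\<eta> $ v * (x $ v - (M + m) / 2)"] by (simp only: abs_mult)
    next
      case False
      then have "\<eta> $ v = 0"
        using assms(1) by (auto simp: edge_flows_def)
      then show ?thesis by simp
    qed
  qed
  also have "\<dots> = l1_norm \<eta> / 2 * edge_range e x"
    unfolding l1_norm_def edge_range_def M_def [symmetric] m_def [symmetric] sum_distrib_right [symmetric]
    by simp
  finally show ?thesis .
qed

lemma weak_duality:
  assumes "weighted_hypergraph E w" "\<eta> \<in> feasible_flows E s"
  shows "- dual_energy E w \<eta> \<le> primal_energy E w s x"
proof -
  have "s \<bullet> x = (\<Sum>e\<in>E. \<eta> e \<bullet> x)"
    using assms(2) by (auto simp: feasible_flows_def boundary_def inner_sum_left)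
  also have "\<dots> \<le> (\<Sum>e\<in>E. (l1_norm (\<eta> e))\<^sup>2 / (8 * w e) + w e * (edge_range e x)\<^sup>2 / 2)"
  proof (rule sum_mono)
    fix e assume e: "e \<in> E"
    then have w: "w e > 0" and ne: "e \<noteq> {}"
      using assms(1) by (auto simp: weighted_hypergraph_def)
    have "\<eta> e \<in> edge_flows e"
      using e assms(2) by (auto simp: feasible_flows_def flow_space_def)
    then have "\<eta> e \<bullet> x \<le> l1_norm (\<eta> e) / 2 * edge_range e x"
      using edge_flow_inner_le ne by blast
    also have "\<dots> \<le> (l1_norm (\<eta> e))\<^sup>2 / (8 * w e) + w e * (edge_range e x)\<^sup>2 / 2"
    proof -
      \<comment> \<open>AM-GM as a completed square. It vanishes when
        \<open>l1_norm (\<eta> e) = 2 * w e * edge_range e x\<close>, the condition that guides the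
        later choice of an optimal flow.\<close>
      have "0 \<le> (l1_norm (\<eta> e) - 2 * w e * edge_range e x)\<^sup>2 / (8 * w e)"
        using w by simp
      also have "\<dots> = (l1_norm (\<eta> e))\<^sup>2 / (8 * w e) + w e * (edge_range e x)\<^sup>2 / 2
          - l1_norm (\<eta> e) / 2 * edge_range e x"
        using w by (simp add: power2_eq_square field_simps)
      finally show ?thesis by simp
    qed
    finally show "\<eta> e \<bullet> x \<le> (l1_norm (\<eta> e))\<^sup>2 / (8 * w e) + w e * (edge_range e x)\<^sup>2 / 2" .
  qed
  also have "\<dots> = dual_energy E w \<eta> + 1 / 2 * (\<Sum>e\<in>E. w e * (edge_range e x)\<^sup>2)"
    by (simp add: dual_energy_def sum.distrib sum_distrib_left)
  finally show ?thesis
    by (simp add: primal_energy_def)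
qed

section \<open>Connectivity, centering and existence of a primal minimiser\<close>

lemma constant_if_edge_ranges_zero:
  assumes "hypergraph_connected E" "\<And>e. e \<in> E \<Longrightarrow> edge_range e x = 0"
  shows "x $ u = x $ v"
proof -
  obtain k :: nat and p e where path: "p 0 = u" "p k = v"
      "\<And>i. i \<in> {1..k} \<Longrightarrow> e i \<in> E \<and> p (i - 1) \<in> e i \<and> p i \<in> e i"
    using assms(1) unfolding hypergraph_connected_def by metis
  have "i \<le> k \<Longrightarrow> x $ p i = x $ u" for i
  proof (induction i)
    case 0
    then show ?case using path by simp
  next
    case (Suc i)
    then have "e (Suc i) \<in> E" "p i \<in> e (Suc i)" "p (Suc i) \<in> e (Suc i)"
      using path(3) [of "Suc i"] by auto
    \<comment> \<open>Consecutive path vertices share a hyperedge, whose range bounds their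
      difference in both directions.\<close>
    then have "x $ p (Suc i) = x $ p i"
      using edge_range_diff_le [of "p i" "e (Suc i)" "p (Suc i)" x]
        edge_range_diff_le [of "p (Suc i)" "e (Suc i)" "p i" x] assms(2) [of "e (Suc i)"] by simp
    with Suc show ?case by simp
  qed
  from this [of k] path show ?thesis by simp
qed

lemma centered_space_eq:
  "centered_space E w = {x. (\<Sum>v\<in>UNIV. degree E w v * x $ v) = 0}"
  by (simp add: centered_space_def degree_matrix_def inner_vec_def matrix_vector_mult_def
      if_distrib [of "\<lambda>a. a * b" for b] cong: if_cong)

lemma subspace_centered_space: "subspace (centered_space E w)"
  unfolding subspace_def centered_space_eq
  by (auto simp: distrib_left sum.distrib mult.left_commute [of _ "_::real" "_ $ _"]
      sum_distrib_left [symmetric])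

lemma sum_degree_pos:
  assumes "weighted_hypergraph E w"
  shows "0 < (\<Sum>v\<in>UNIV. degree E w v)"
proof -
  have w: "\<And>e. e \<in> E \<Longrightarrow> w e > 0"
    using assms by (auto simp: weighted_hypergraph_def)
  obtain e v where "e \<in> E" "v \<in> e"
    using assms by (metis weighted_hypergraph_def all_not_in_conv)
  then have "0 < degree E w v"
    unfolding degree_def using w by (intro sum_pos) auto
  moreover have "0 \<le> degree E w u" for u
    unfolding degree_def using w by (intro sum_nonneg) (auto intro: less_imp_le)
  ultimately show ?thesis
    by (intro sum_pos2 [of _ v]) auto
qed

lemma primal_energy_add_const:
  assumes "weighted_hypergraph E w" "1 \<bullet> s = 0"
  shows "primal_energy E w s (x + c *\<^sub>R 1) = primal_energy E w s x"
proof -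
  have "(\<Sum>e\<in>E. w e * (edge_range e (x + c *\<^sub>R 1))\<^sup>2) = (\<Sum>e\<in>E. w e * (edge_range e x)\<^sup>2)"
    using assms(1) by (intro sum.cong) (auto simp: weighted_hypergraph_def edge_range_add_const)
  then show ?thesis
    using assms(2) by (simp add: primal_energy_def inner_add_right inner_commute)
qed

text \<open>Combined with invariance of the energy under constants, this turns a minimiser over the
  centered space into a minimiser over all vectors.\<close>

lemma add_const_in_centered_space:
  assumes "weighted_hypergraph E w"
  obtains c where "x + c *\<^sub>R 1 \<in> centered_space E w"
proof -
  let ?D = "\<Sum>v\<in>UNIV. degree E w v" and ?S = "\<Sum>v\<in>UNIV. degree E w v * x $ v"
  \<comment> \<open>The shift is minus the degree-weighted mean of \<open>x\<close>.\<close>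
  have "(\<Sum>v\<in>UNIV. degree E w v * (x + (- ?S / ?D) *\<^sub>R 1) $ v) = ?S + (- ?S / ?D) * ?D"
    unfolding sum_distrib_left [of _ _ UNIV] sum.distrib [symmetric]
    by (intro sum.cong refl) (simp add: algebra_simps)
  also have "\<dots> = 0"
    using sum_degree_pos [OF assms] by simp
  finally show ?thesis
    using that unfolding centered_space_eq by blast
qed

text \<open>This quadratic growth lets the range terms dominate the linear term
  \<open>s \<bullet> x\<close> far from the origin.\<close>

lemma range_energy_coercive:
  assumes "weighted_hypergraph E w" "hypergraph_connected E"
  obtains c where "0 < c"
    "\<And>x. x \<in> centered_space E w \<Longrightarrow> c * (norm x)\<^sup>2 \<le> 1 / 2 * (\<Sum>e\<in>E. w e * (edge_range e x)\<^sup>2)"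
proof -
  define f where "f x = 1 / 2 * (\<Sum>e\<in>E. w e * (edge_range e x)\<^sup>2)" for x
  let ?S = "sphere 0 1 \<inter> centered_space E w"
  have w: "\<And>e. e \<in> E \<Longrightarrow> w e > 0" and ne: "\<And>e. e \<in> E \<Longrightarrow> e \<noteq> {}"
    using assms(1) by (auto simp: weighted_hypergraph_def)
  have cont: "continuous_on ?S f"
    unfolding f_def by (intro continuous_intros continuous_on_edge_range ne)
  have compact: "compact ?S"
    by (intro compact_Int_closed compact_sphere closed_subspace subspace_centered_space)
  \<comment> \<open>If all ranges vanish, connectivity makes \<open>x\<close> constant; a constant
    vector in the centered space is zero, contrary to unit norm.\<close>
  have pos: "0 < f x" if "x \<in> ?S" for x
  proof (rule ccontr)
    assume "\<not> 0 < f x"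
    moreover have nonneg: "0 \<le> w e * (edge_range e x)\<^sup>2" if "e \<in> E" for e
      using w [OF that] by simp
    then have "0 \<le> f x"
      unfolding f_def by (simp add: sum_nonneg)
    ultimately have "(\<Sum>e\<in>E. w e * (edge_range e x)\<^sup>2) = 0"
      by (simp add: f_def)
    then have "\<And>e. e \<in> E \<Longrightarrow> w e * (edge_range e x)\<^sup>2 = 0"
      using nonneg by (simp add: sum_nonneg_eq_0_iff)
    then have "\<And>e. e \<in> E \<Longrightarrow> edge_range e x = 0"
      using w by fastforce
    then have const: "x $ u = x $ v" for u v
      using constant_if_edge_ranges_zero assms(2) by blast
    obtain v0 :: 'a where True by simp
    have "(\<Sum>v\<in>UNIV. degree E w v) * x $ v0 = (\<Sum>v\<in>UNIV. degree E w v * x $ v)"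
      unfolding sum_distrib_right using const by (intro sum.cong refl) metis
    also have "\<dots> = 0"
      using that by (auto simp: centered_space_eq)
    finally have "x $ v0 = 0"
      using sum_degree_pos [OF assms(1)] by simp
    then have "x = 0"
      using const by (metis vec_eq_iff zero_index)
    with that show False by simp
  qed
  obtain c where c: "0 < c" "\<And>x. x \<in> ?S \<Longrightarrow> c \<le> f x"
  \<comment> \<open>The set is empty when there is a single vertex, since the centered space is then
    trivial; any positive constant serves.\<close>
  proof (cases "?S = {}")
    case True
    then show ?thesis using that [of 1] by auto
  next
    case False
    then obtain y where "y \<in> ?S" "\<And>x. x \<in> ?S \<Longrightarrow> f y \<le> f x"
      using continuous_attains_inf [OF compact _ cont] by blast
    then show ?thesis using that pos by blast
  qed
  have "c * (norm x)\<^sup>2 \<le> f x" if x: "x \<in> centered_space E w" for x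
  proof (cases "x = 0")
    case True
    have "0 \<le> f x"
      unfolding f_def using w by (simp add: sum_nonneg less_imp_le)
    with True show ?thesis by simp
  next
    case False
    let ?y = "(1 / norm x) *\<^sub>R x"
    have "?y \<in> ?S"
      using False x subspace_centered_space by (auto intro: subspace_scale)
    then have "c * (norm x)\<^sup>2 \<le> (norm x)\<^sup>2 * f ?y"
      using mult_left_mono [OF c(2) [of ?y], of "(norm x)\<^sup>2"] by (simp add: mult.commute)
    also have "\<dots> = 1 / 2 * (\<Sum>e\<in>E. w e * (edge_range e (norm x *\<^sub>R ?y))\<^sup>2)"
      unfolding f_def sum_distrib_left
      by (intro sum.cong refl) (subst edge_range_scaleR, auto simp: ne power_mult_distrib)
    also have "\<dots> = f x"
      using False by (simp add: f_def)
    finally show ?thesis .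
  qed
  with c(1) show ?thesis
    using that unfolding f_def by blast
qed

lemma primal_minimiser_exists:
  assumes "weighted_hypergraph E w" "hypergraph_connected E"
  obtains x where "x \<in> centered_space E w"
    "\<And>y. y \<in> centered_space E w \<Longrightarrow> primal_energy E w s x \<le> primal_energy E w s y"
proof -
  obtain c where c: "0 < c"
    "\<And>x. x \<in> centered_space E w \<Longrightarrow> c * (norm x)\<^sup>2 \<le> 1 / 2 * (\<Sum>e\<in>E. w e * (edge_range e x)\<^sup>2)"
    using range_energy_coercive [OF assms] by blast
  have ne: "\<And>e. e \<in> E \<Longrightarrow> e \<noteq> {}"
    using assms(1) by (auto simp: weighted_hypergraph_def)
  \<comment> \<open>Outside this radius \<open>c * (norm y)\<^sup>2\<close> exceeds
    \<open>norm s * norm y\<close>, so the energy is nonnegative there and no better than its value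
    0 at the origin, which lies in the ball.\<close>
  let ?S = "cball 0 (norm s / c) \<inter> centered_space E w"
  have zero: "0 \<in> ?S"
    using c(1) subspace_centered_space by (auto intro: subspace_0)
  have "edge_range e 0 = 0" if "e \<in> E" for e
    using edge_range_scaleR [OF ne [OF that], of 0 0] by simp
  then have energy_zero: "primal_energy E w s 0 = 0"
    by (simp add: primal_energy_def)
  have "compact ?S"
    by (intro compact_Int_closed compact_cball closed_subspace subspace_centered_space)
  moreover have "continuous_on ?S (primal_energy E w s)"
    unfolding primal_energy_def by (intro continuous_intros continuous_on_edge_range ne)
  ultimately obtain x where x: "x \<in> ?S" "\<And>y. y \<in> ?S \<Longrightarrow> primal_energy E w s x \<le> primal_energy E w s y"
    using continuous_attains_inf zero by (metis empty_iff)
  have "primal_energy E w s x \<le> primal_energy E w s y" if y: "y \<in> centered_space E w" for y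
  proof (cases "norm y \<le> norm s / c")
    case True
    then show ?thesis using x y by simp
  next
    case False
    then have "norm s \<le> c * norm y"
      using c(1) by (simp add: field_simps)
    then have "norm s * norm y \<le> c * (norm y)\<^sup>2"
      using mult_right_mono [of "norm s" "c * norm y" "norm y"] by (simp add: power2_eq_square)
    then have "0 \<le> primal_energy E w s y"
      using c(2) [OF y] norm_cauchy_schwarz [of s y] by (simp add: primal_energy_def)
    then show ?thesis
      using x(2) [OF zero] energy_zero by simp
  qed
  with x(1) show ?thesis using that by blast
qed

section \<open>First-order optimality and the dual certificate\<close>

definition active_dipoles :: "'v::finite set \<Rightarrow> real ^ 'v \<Rightarrow> (real ^ 'v) set" where
  "active_dipoles e x = {a \<in> dipoles e. a \<bullet> x = edge_range e x}"

text \<open>A generator picks one active dipole per hyperedge, independently. Extensional choice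
  functions keep the generators finite in number, so their hull is closed and can be strictly
  separated from \<open>s\<close>.\<close>

lemma minimiser_in_subdifferential:
  fixes x s :: "real ^ 'v::finite"
  assumes "weighted_hypergraph E w"
    and min: "\<And>y. primal_energy E w s x \<le> primal_energy E w s y"
  shows "s \<in> convex hull
    ((\<lambda>a. \<Sum>e\<in>E. (w e * edge_range e x) *\<^sub>R a e) ` (\<Pi>\<^sub>E e\<in>E. active_dipoles e x))"
    (is "s \<in> convex hull ?G")
proof (rule ccontr)
  assume "s \<notin> convex hull ?G"
  have w: "\<And>e. e \<in> E \<Longrightarrow> w e > 0" and ne: "\<And>e. e \<in> E \<Longrightarrow> e \<noteq> {}"
    using assms(1) by (auto simp: weighted_hypergraph_def)
  have "finite ?G"
    by (intro finite_imageI finite_PiE) (auto simp: active_dipoles_def)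
  then have "closed (convex hull ?G)"
    by (intro compact_imp_closed finite_imp_compact_convex_hull)
  then obtain d' b where "d' \<bullet> s < b" "\<And>g. g \<in> convex hull ?G \<Longrightarrow> b < d' \<bullet> g"
    using separating_hyperplane_closed_point [OF convex_convex_hull _ \<open>s \<notin> convex hull ?G\<close>] by blast
  then have d: "g \<bullet> - d' < s \<bullet> - d'" if "g \<in> ?G" for g
    using hull_inc [OF that, of convex] by (fastforce simp: inner_commute)
  \<comment> \<open>The separation theorem puts \<open>s\<close> on the low side; the sign is
    flipped so that \<open>s\<close> has the larger inner product with \<open>d\<close>.\<close>
  define d where "d = - d'"
  \<comment> \<open>The steepest active dipole gives the one-sided derivative of the range at
    \<open>x\<close> in direction \<open>d\<close>.\<close>
  have "\<exists>a. a \<in> active_dipoles e x \<and> (\<forall>a'\<in>active_dipoles e x. a' \<bullet> d \<le> a \<bullet> d)" if "e \<in> E" for e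
  proof -
    have fin: "finite ((\<lambda>a. a \<bullet> d) ` active_dipoles e x)"
      by (simp add: active_dipoles_def)
    have "active_dipoles e x \<noteq> {}"
      using edge_range_attained [OF ne [OF that], of x] by (auto simp: active_dipoles_def)
    then have "Max ((\<lambda>a. a \<bullet> d) ` active_dipoles e x) \<in> (\<lambda>a. a \<bullet> d) ` active_dipoles e x"
      using fin by (intro Max_in) auto
    then obtain a where "a \<in> active_dipoles e x" "a \<bullet> d = Max ((\<lambda>a. a \<bullet> d) ` active_dipoles e x)"
      by auto
    then show ?thesis using fin by auto
  qed
  then obtain a where a: "\<And>e. e \<in> E \<Longrightarrow> a e \<in> active_dipoles e x"
      "\<And>e a'. e \<in> E \<Longrightarrow> a' \<in> active_dipoles e x \<Longrightarrow> a' \<bullet> d \<le> a e \<bullet> d"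
    by metis
  define g where "g = (\<Sum>e\<in>E. (w e * edge_range e x) *\<^sub>R a e)"
  have "g = (\<Sum>e\<in>E. (w e * edge_range e x) *\<^sub>R (restrict a E) e)"
    by (simp add: g_def)
  moreover have "restrict a E \<in> (\<Pi>\<^sub>E e\<in>E. active_dipoles e x)"
    using a(1) by auto
  ultimately have "g \<in> ?G" by blast
  then have descent: "g \<bullet> d < s \<bullet> d"
    using d unfolding d_def by blast
  \<comment> \<open>Coefficient of \<open>t\<^sup>2\<close> when the ranges are replaced by their
    first-order models; for small \<open>t\<close> it cannot offset the linear gain.\<close>
  define K where "K = 1 / 2 * (\<Sum>e\<in>E. w e * (a e \<bullet> d)\<^sup>2)"
  have "\<forall>\<^sub>F t in at_right 0. t * K < s \<bullet> d - g \<bullet> d"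
  proof (rule order_tendstoD)
    show "((\<lambda>t. t * K) \<longlongrightarrow> 0 * K) (at_right 0)"
      by (intro tendsto_intros)
  qed (use descent in simp)
  \<comment> \<open>The first-order model bounds the range from above for small
    \<open>t > 0\<close>: active dipoles obey it by the maximal slope of \<open>a e\<close>,
    inactive ones because their strict gap at \<open>t = 0\<close> persists.\<close>
  moreover have "\<forall>\<^sub>F t in at_right 0. \<forall>e\<in>E. \<forall>b\<in>dipoles e. b \<bullet> (x + t *\<^sub>R d) \<le> edge_range e x + t * (a e \<bullet> d)"
  proof (intro eventually_ball_finite ballI finite finite_dipoles)
    fix e b assume e: "e \<in> E" and b: "b \<in> dipoles e"
    show "\<forall>\<^sub>F t in at_right 0. b \<bullet> (x + t *\<^sub>R d) \<le> edge_range e x + t * (a e \<bullet> d)"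
    proof (cases "b \<in> active_dipoles e x")
      case True
      then have "b \<bullet> (x + t *\<^sub>R d) \<le> edge_range e x + t * (a e \<bullet> d)" if "t > 0" for t
        using a(2) [OF e True] that by (auto simp: active_dipoles_def inner_add_right mult_left_mono)
      then show ?thesis
        by (auto intro: eventually_mono [OF eventually_at_right_less])
    next
      case False
      then have "b \<bullet> x < edge_range e x"
        using dipole_inner_le_edge_range [OF b, of x] b by (auto simp: active_dipoles_def less_le)
      moreover have "((\<lambda>t. edge_range e x + t * (a e \<bullet> d) - b \<bullet> (x + t *\<^sub>R d)) \<longlongrightarrow>
          edge_range e x + 0 * (a e \<bullet> d) - b \<bullet> (x + 0 *\<^sub>R d)) (at_right 0)"
        by (intro tendsto_intros)
      ultimately have "\<forall>\<^sub>F t in at_right 0. 0 < edge_range e x + t * (a e \<bullet> d) - b \<bullet> (x + t *\<^sub>R d)"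
        by (intro order_tendstoD) auto
      then show ?thesis
        by (rule eventually_mono) simp
    qed
  qed
  \<comment> \<open>Any \<open>t\<close> satisfying all these conditions gives a point of lower
    energy than \<open>x\<close>, and the filter is nontrivial.\<close>
  ultimately have "\<forall>\<^sub>F t in at_right (0::real). False"
    using eventually_at_right_less [of 0]
  proof eventually_elim
    case (elim t)
    have "1 / 2 * (\<Sum>e\<in>E. w e * (edge_range e (x + t *\<^sub>R d))\<^sup>2)
        \<le> 1 / 2 * (\<Sum>e\<in>E. w e * (edge_range e x + t * (a e \<bullet> d))\<^sup>2)"
    proof (intro mult_left_mono sum_mono power_mono)
      fix e assume e: "e \<in> E"
      obtain b where "b \<in> dipoles e" "b \<bullet> (x + t *\<^sub>R d) = edge_range e (x + t *\<^sub>R d)"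
        using edge_range_attained [OF ne [OF e]] .
      then show "edge_range e (x + t *\<^sub>R d) \<le> edge_range e x + t * (a e \<bullet> d)"
        using elim e by metis
    qed (simp_all add: less_imp_le w ne edge_range_nonneg)
    also have "\<dots> = 1 / 2 * (\<Sum>e\<in>E. w e * (edge_range e x)\<^sup>2) + t * (g \<bullet> d) + t * (t * K)"
      unfolding g_def K_def inner_sum_left sum_distrib_left sum.distrib [symmetric]
      by (intro sum.cong refl) (simp add: power2_eq_square field_simps)
    also have "\<dots> < 1 / 2 * (\<Sum>e\<in>E. w e * (edge_range e x)\<^sup>2) + t * (g \<bullet> d) + t * (s \<bullet> d - g \<bullet> d)"
      using elim by simp
    finally have "primal_energy E w s (x + t *\<^sub>R d) < primal_energy E w s x"
      by (simp add: primal_energy_def inner_add_right algebra_simps)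
    with min [of "x + t *\<^sub>R d"] show False by simp
  qed
  then show False by simp
qed

lemma dual_certificate:
  fixes x s :: "real ^ 'v::finite"
  assumes "weighted_hypergraph E w"
    and min: "\<And>y. primal_energy E w s x \<le> primal_energy E w s y"
  obtains \<eta> where "\<eta> \<in> feasible_flows E s" "dual_energy E w \<eta> \<le> - primal_energy E w s x"
proof -
  have w: "\<And>e. e \<in> E \<Longrightarrow> w e > 0" and ne: "\<And>e. e \<in> E \<Longrightarrow> e \<noteq> {}"
    using assms(1) by (auto simp: weighted_hypergraph_def)
  \<comment> \<open>Flows for which both inequalities of weak duality are tight at \<open>x\<close>.
    The l1 condition is stated as an upper bound rather than an equality so that \<open>H e\<close>
    is visibly convex.\<close>
  define H where "H e = {h \<in> edge_flows e. l1_norm h \<le> 2 * w e * edge_range e x \<and>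
      h \<bullet> x = w e * (edge_range e x)\<^sup>2}" for e
  have convex_H: "convex (H e)" for e
  proof (rule convexI)
    fix y z :: "real ^ 'v" and p q :: real
    assume H: "y \<in> H e" "z \<in> H e" and pq: "0 \<le> p" "0 \<le> q" "p + q = 1"
    have "l1_norm (p *\<^sub>R y + q *\<^sub>R z) \<le> p * l1_norm y + q * l1_norm z"
      using l1_norm_add_le [of "p *\<^sub>R y" "q *\<^sub>R z"] pq by (simp add: l1_norm_scaleR)
    also have "\<dots> \<le> 2 * w e * edge_range e x"
      using H pq by (intro convex_bound_le) (auto simp: H_def)
    finally have "l1_norm (p *\<^sub>R y + q *\<^sub>R z) \<le> 2 * w e * edge_range e x" .
    moreover have "p *\<^sub>R y + q *\<^sub>R z \<in> edge_flows e"
      using H by (simp add: H_def subspace_add subspace_scale subspace_edge_flows)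
    moreover have "(p *\<^sub>R y + q *\<^sub>R z) \<bullet> x = (p + q) * (w e * (edge_range e x)\<^sup>2)"
      using H by (simp add: H_def inner_add_left distrib_right)
    ultimately show "p *\<^sub>R y + q *\<^sub>R z \<in> H e"
      using pq by (simp add: H_def)
  qed
  have "convex (boundary E ` (\<Pi>\<^sub>E e\<in>E. H e))"
  proof (rule convexI)
    fix y z :: "real ^ 'v" and p q :: real
    assume "y \<in> boundary E ` (\<Pi>\<^sub>E e\<in>E. H e)" "z \<in> boundary E ` (\<Pi>\<^sub>E e\<in>E. H e)"
      and pq: "0 \<le> p" "0 \<le> q" "p + q = 1"
    then obtain \<xi> \<zeta> where *: "\<xi> \<in> (\<Pi>\<^sub>E e\<in>E. H e)" "y = boundary E \<xi>" "\<zeta> \<in> (\<Pi>\<^sub>E e\<in>E. H e)" "z = boundary E \<zeta>"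
      by auto
    \<comment> \<open>The combination is formed hyperedge by hyperedge and restricted to
      \<open>E\<close>, as the extensional product demands.\<close>
    let ?\<eta> = "\<lambda>e\<in>E. p *\<^sub>R \<xi> e + q *\<^sub>R \<zeta> e"
    have "?\<eta> \<in> (\<Pi>\<^sub>E e\<in>E. H e)"
      unfolding restrict_PiE_iff
      by (intro ballI convexD [OF convex_H _ _ pq] PiE_mem [OF *(1)] PiE_mem [OF *(3)])
    moreover have "p *\<^sub>R y + q *\<^sub>R z = boundary E ?\<eta>"
      using * by (simp add: boundary_def scaleR_sum_right sum.distrib)
    ultimately show "p *\<^sub>R y + q *\<^sub>R z \<in> boundary E ` (\<Pi>\<^sub>E e\<in>E. H e)"
      by blast
  qed
  moreover have "(\<lambda>a. \<Sum>e\<in>E. (w e * edge_range e x) *\<^sub>R a e) ` (\<Pi>\<^sub>E e\<in>E. active_dipoles e x)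
      \<subseteq> boundary E ` (\<Pi>\<^sub>E e\<in>E. H e)"
  proof (rule image_subsetI)
    fix a assume a: "a \<in> (\<Pi>\<^sub>E e\<in>E. active_dipoles e x)"
    let ?\<eta> = "\<lambda>e\<in>E. (w e * edge_range e x) *\<^sub>R a e"
    have "(w e * edge_range e x) *\<^sub>R a e \<in> H e" if e: "e \<in> E" for e
    proof -
      have ae: "a e \<in> dipoles e" "a e \<bullet> x = edge_range e x"
        using a e by (auto simp: active_dipoles_def)
      have c: "0 \<le> w e * edge_range e x"
        using w [OF e] edge_range_nonneg [OF ne [OF e], of x] by simp
      have "(w e * edge_range e x) *\<^sub>R a e \<in> edge_flows e"
        using ae(1) dipoles_subset_edge_flows by (blast intro: subspace_scale subspace_edge_flows)
      moreover have "l1_norm ((w e * edge_range e x) *\<^sub>R a e) \<le> 2 * w e * edge_range e x"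
        using mult_left_mono [OF l1_norm_dipole_le [OF ae(1)] c] c
        by (simp add: l1_norm_scaleR)
      moreover have "((w e * edge_range e x) *\<^sub>R a e) \<bullet> x = w e * (edge_range e x)\<^sup>2"
        by (simp add: ae(2) power2_eq_square)
      ultimately show ?thesis
        by (simp add: H_def)
    qed
    then have "?\<eta> \<in> (\<Pi>\<^sub>E e\<in>E. H e)"
      by auto
    moreover have "(\<Sum>e\<in>E. (w e * edge_range e x) *\<^sub>R a e) = boundary E ?\<eta>"
      by (simp add: boundary_def)
    ultimately show "(\<Sum>e\<in>E. (w e * edge_range e x) *\<^sub>R a e) \<in> boundary E ` (\<Pi>\<^sub>E e\<in>E. H e)"
      by blast
  qed
  \<comment> \<open>A convex set containing the generators contains their hull, hence
    \<open>s\<close>.\<close>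
  ultimately have "s \<in> boundary E ` (\<Pi>\<^sub>E e\<in>E. H e)"
    using subsetD [OF hull_minimal minimiser_in_subdifferential [OF assms]] by simp
  then obtain \<eta> where \<eta>: "\<eta> \<in> (\<Pi>\<^sub>E e\<in>E. H e)" "s = boundary E \<eta>"
    by (elim imageE)
  then have \<eta>H: "\<eta> e \<in> H e" if "e \<in> E" for e
    using that by auto
  have feasible: "\<eta> \<in> feasible_flows E s"
    using \<eta> by (auto simp: feasible_flows_def flow_space_def H_def PiE_iff)
  have "s \<bullet> x = (\<Sum>e\<in>E. \<eta> e \<bullet> x)"
    by (simp add: \<eta>(2) boundary_def inner_sum_left)
  also have "\<dots> = (\<Sum>e\<in>E. w e * (edge_range e x)\<^sup>2)"
    using \<eta>H by (intro sum.cong) (auto simp: H_def)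
  \<comment> \<open>Tightness makes \<open>s \<bullet> x\<close> twice the quadratic part of the
    energy at \<open>x\<close>.\<close>
  finally have "- primal_energy E w s x = 1 / 2 * (\<Sum>e\<in>E. w e * (edge_range e x)\<^sup>2)"
    by (simp add: primal_energy_def)
  moreover have "dual_energy E w \<eta> \<le> 1 / 2 * (\<Sum>e\<in>E. w e * (edge_range e x)\<^sup>2)"
    unfolding dual_energy_def sum_distrib_left
  proof (rule sum_mono)
    fix e assume e: "e \<in> E"
    have "(l1_norm (\<eta> e))\<^sup>2 \<le> (2 * w e * edge_range e x)\<^sup>2"
      using \<eta>H [OF e] l1_norm_nonneg by (intro power_mono) (auto simp: H_def)
    then show "(l1_norm (\<eta> e))\<^sup>2 / (8 * w e) \<le> 1 / 2 * (w e * (edge_range e x)\<^sup>2)"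
      using w [OF e] by (simp add: field_simps power2_eq_square)
  qed
  ultimately show ?thesis
    using that feasible by simp
qed

section \<open>Attainment on both sides and zero duality gap\<close>

theorem theorem2p6:
  fixes E :: "'v::finite set set" and w :: "'v set \<Rightarrow> real" and s :: "real ^ 'v"
  assumes "weighted_hypergraph E w"
    and "hypergraph_connected E"
    and "1 \<bullet> s = 0"
  shows "feasible_flows E s \<noteq> {}
    \<and> (\<exists>x. is_arg_min (primal_energy E w s) (\<lambda>x. x \<in> centered_space E w) x)
    \<and> (\<exists>\<eta>. is_arg_min (dual_energy E w) (\<lambda>\<eta>. \<eta> \<in> feasible_flows E s) \<eta>)
    \<and> OPT E w s = - dual_OPT E w s"
proof -
  obtain x where x: "x \<in> centered_space E w"
      "\<And>y. y \<in> centered_space E w \<Longrightarrow> primal_energy E w s x \<le> primal_energy E w s y"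
    using primal_minimiser_exists [OF assms(1,2)] by blast
  \<comment> \<open>The certificate needs minimality in every direction, not only within the
    centered space.\<close>
  have "primal_energy E w s x \<le> primal_energy E w s y" for y
  proof -
    obtain c where "y + c *\<^sub>R 1 \<in> centered_space E w"
      using add_const_in_centered_space [OF assms(1)] .
    then show ?thesis
      using x(2) primal_energy_add_const [OF assms(1,3)] by metis
  qed
  then obtain \<eta> where \<eta>: "\<eta> \<in> feasible_flows E s" "dual_energy E w \<eta> \<le> - primal_energy E w s x"
    using dual_certificate [OF assms(1)] by blast
  have gap: "- primal_energy E w s x \<le> dual_energy E w \<xi>" if "\<xi> \<in> feasible_flows E s" for \<xi>
    using weak_duality [OF assms(1) that, of x] by simp
  have min: "dual_energy E w \<eta> \<le> dual_energy E w \<xi>" if "\<xi> \<in> feasible_flows E s" for \<xi>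
    using gap [OF that] \<eta>(2) by simp
  have "OPT E w s = primal_energy E w s x"
    unfolding OPT_def using x by (intro Least_equality) auto
  moreover have "dual_OPT E w s = dual_energy E w \<eta>"
    unfolding dual_OPT_def using \<eta>(1) min by (intro Least_equality) auto
  moreover have "dual_energy E w \<eta> = - primal_energy E w s x"
    using gap [OF \<eta>(1)] \<eta>(2) by simp
  ultimately show ?thesis
    using x \<eta>(1) min by (auto simp: is_arg_min_linorder)
qed

end
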